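(* Let $(\Omega,\Sigma,P)$, $\Theta$, $D$, $\{P_\theta\}_{\theta\in D}$, $N$, $X=\{X_n\}_{n\in\mathbb N}$, $S$ be as described in the context; in particular $X$ is $P$-conditionally i.i.d. given $\Theta$ and $P$-conditionally mutually independent of $N$ given $\Theta$, and $P_{X_1}(\mathbb N_0)=1$. For $x\in R_S$ let $\rho_x$ be the probability measure on $\Sigma$ given by $$\rho_x(A):=\frac{\mathbb E_P[\mathbf 1_A\cdot\mathbf 1_{\{S=x\}}]}{\mathbb E_P[\mathbf 1_{\{S=x\}}]}\quad\text{for any }A\in\Sigma,$$ and let $g(x):=P(S=x)$. If $P_N\in\mathbf{Panjer}(a,b;0)$ for real constants $a,b$, and $N$ and $\Theta$ are $P$-independent, then $$g(x)=\begin{cases}\mathbb E_P\big[m_N\big(f_{X_1\mid\Theta}(0)\big)\big], & x=0,\\[2pt] \sum_{y=1}^{x}D_{x,y}\cdot g(x-y), & x\in R_S\setminus\{0\},\end{cases}$$ where $$D_{x,y}=\Big(a+b\cdot\frac{y}{x}\Big)\cdot\mathbb E_{\rho_{x-y}}\Big[\frac{f_{X_1\mid\Theta}(y)}{1-a\cdot f_{X_1\mid\Theta}(0)}\Big]$$ for any $x\in R_S\setminus\{0\}$ and $y\in\{1,\dots,x\}$.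
   Context: Setting. $(\Omega,\Sigma,P)$ is a probability space; $\mathbb N_0=\{0,1,2,\dots\}$. $N$ is an $\mathbb N_0$-valued random variable; $\Theta$ is a $d$-dimensional random vector with values in $D\subseteq\mathbb R^d$, $\mathfrak B(D)$ is the Borel $\sigma$-algebra of $D$ and $P_\Theta$ the distribution of $\Theta$. $X=\{X_n\}_{n\in\mathbb N}$ is a sequence of nonnegative random variables on $\Omega$, and $S:=\sum_{j=1}^N X_j$ if $N\ge1$, $S:=0$ if $N=0$. $P_Z$ denotes the distribution of a random variable $Z$ under $P$. $R_S\subseteq\mathbb N_0$ is the set of values of $S$, with $P(S=x)>0$ for all $x\in R_S$. It is assumed that $\{P_\theta\}_{\theta\in D}$ is a regular conditional probability of $P$ over $P_\Theta$ consistent with $\Theta$: a family of probability measures on $\Sigma$ such that $\theta\mapsto P_\theta(E)$ is $\mathfrak B(D)$-measurable and $\int_D P_\theta(E)\,P_\Theta(d\theta)=P(E)$ for each $E\in\Sigma$, and for each $B\in\mathfrak B(D)$, $P_\theta(\Theta^{-1}[B])=1$ for $P_\Theta$-almost all $\theta\in B$. $X$ is $P$-conditionally i.i.d. given $\Theta$: for distinct indices $i_1,\dots,i_n$ and reals $z_1,\dots,z_n$, $P(X_{i_1}\le z_1,\dots,X_{i_n}\le z_n\mid\Theta)=\prod_k P(X_{i_k}\le z_k\mid\Theta)$ $P$-a.s., and $P(F\cap X_k^{-1}[B])=P(F\cap X_m^{-1}[B])$ for all $k,m\in\mathbb N$, $F\in\sigma(\Theta)$ and Borel $B\subseteq\mathbb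 R$. $X$ is $P$-conditionally mutually independent of $N$ given $\Theta$: $\sigma(X)$ and $\sigma(N)$ are $P$-conditionally independent given $\sigma(\Theta)$. $P_N\in\mathbf{Panjer}(a,b;0)$ means $P(N=n)=\big(a+\frac bn\big)P(N=n-1)$ for all $n\ge1$. $f_{X_1\mid\Theta}(x)=f_\Theta(x)$, where $f_\theta(x):=P_\theta(X_1=x)$ for $\theta\in D$ and $x\in\mathbb N_0$; thus $f_{X_1\mid\Theta}(x)=P(X_1=x\mid\Theta)$ $P$-a.s. $m_N(t):=\mathbb E_P[t^N]=\sum_{n\ge0}P(N=n)t^n$ for $|t|\le1$ (with $0^0=1$). Convention: if $x-y\notin R_S$ (so $g(x-y)=0$), the term $D_{x,y}\cdot g(x-y)$ is read as $0$. *)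

theory Defs
  imports "HOL-Probability.Probability"
begin

section \<open>Sigma-algebras generated by random variables, conditional probabilities\<close>

definition gen_alg :: "'w measure \<Rightarrow> 'b measure \<Rightarrow> ('w \<Rightarrow> 'b) \<Rightarrow> 'w measure" where
  "gen_alg M T Z = vimage_algebra (space M) Z T"

text \<open>The sequence is indexed by the positive integers; the value at index 0 is never used.\<close>

definition seq_events :: "'w measure \<Rightarrow> (nat \<Rightarrow> 'w \<Rightarrow> real) \<Rightarrow> 'w set set" where
  "seq_events M X =
     sigma_sets (space M) {X n -` B \<inter> space M | n B. n \<ge> 1 \<and> B \<in> sets borel}"

text \<open>A version of the conditional probability of an event given a sub-sigma-algebra; it is only
  determined up to null sets, so it is only used in almost-sure statements.\<close>

definition cprob :: "'w measure \<Rightarrow> 'w measure \<Rightarrow> 'w set \<Rightarrow> 'w \<Rightarrow> real" where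
  "cprob M F A = real_cond_exp M F (indicator A)"

definition cond_indep_sets :: "'w measure \<Rightarrow> 'w measure \<Rightarrow> 'w set set \<Rightarrow> 'w set set \<Rightarrow> bool" where
  "cond_indep_sets M F \<A> \<B> \<longleftrightarrow>
     (\<forall>A\<in>\<A>. \<forall>B\<in>\<B>. AE \<omega> in M. cprob M F (A \<inter> B) \<omega> = cprob M F A \<omega> * cprob M F B \<omega>)"

definition cond_iid :: "'w measure \<Rightarrow> 'w measure \<Rightarrow> (nat \<Rightarrow> 'w \<Rightarrow> real) \<Rightarrow> bool" where
  "cond_iid M F X \<longleftrightarrow>
     (\<forall>I z. finite I \<and> I \<noteq> {} \<and> I \<subseteq> {1..} \<longrightarrow>
        (AE \<omega> in M. cprob M F {\<omega>' \<in> space M. \<forall>i\<in>I. X i \<omega>' \<le> z i} \<omega>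
                   = (\<Prod>i\<in>I. cprob M F {\<omega>' \<in> space M. X i \<omega>' \<le> z i} \<omega>))) \<and>
     (\<forall>k\<ge>1. \<forall>m\<ge>1. \<forall>E\<in>sets F. \<forall>B\<in>sets borel.
        measure M (E \<inter> (X k -` B \<inter> space M)) = measure M (E \<inter> (X m -` B \<inter> space M)))"

section \<open>Regular conditional probabilities consistent with a random vector\<close>

text \<open>\<open>T\<close> is the target space of \<open>\<Theta>\<close>.\<close>

definition consistent_rcp ::
  "'w measure \<Rightarrow> 't measure \<Rightarrow> ('w \<Rightarrow> 't) \<Rightarrow> ('t \<Rightarrow> 'w measure) \<Rightarrow> bool" where
  "consistent_rcp M T \<Theta> K \<longleftrightarrow>
     (\<forall>\<theta>\<in>space T. prob_space (K \<theta>) \<and> sets (K \<theta>) = sets M) \<and>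
     (\<forall>E\<in>sets M. (\<lambda>\<theta>. measure (K \<theta>) E) \<in> borel_measurable T \<and>
                  (\<integral>\<theta>. measure (K \<theta>) E \<partial>(distr M T \<Theta>)) = measure M E) \<and>
     (\<forall>B\<in>sets T. AE \<theta> in distr M T \<Theta>. \<theta> \<in> B \<longrightarrow> measure (K \<theta>) (\<Theta> -` B \<inter> space M) = 1)"

section \<open>Claim numbers and aggregate claims\<close>

definition panjer0 :: "real \<Rightarrow> real \<Rightarrow> nat measure \<Rightarrow> bool" where
  "panjer0 a b Q \<longleftrightarrow> (\<forall>n\<ge>1. measure Q {n} = (a + b / real n) * measure Q {n - 1})"

definition prob_gen :: "'w measure \<Rightarrow> ('w \<Rightarrow> nat) \<Rightarrow> real \<Rightarrow> real" where
  "prob_gen M N t = (\<integral>\<omega>. t ^ N \<omega> \<partial>M)"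

definition agg_sum :: "(nat \<Rightarrow> 'w \<Rightarrow> real) \<Rightarrow> ('w \<Rightarrow> nat) \<Rightarrow> 'w \<Rightarrow> real" where
  "agg_sum X N \<omega> = (\<Sum>j=1..N \<omega>. X j \<omega>)"

definition pmass :: "'w measure \<Rightarrow> ('w \<Rightarrow> real) \<Rightarrow> nat \<Rightarrow> real" where
  "pmass M Z x = measure M {\<omega> \<in> space M. Z \<omega> = real x}"

text \<open>The set \<open>R\<^sub>S\<close> of values of \<open>Z = S\<close>: the values in \<open>\<nat>\<close> that are attained with positive
  probability.  Values on a null set do not count.\<close>

definition val_set :: "'w measure \<Rightarrow> ('w \<Rightarrow> real) \<Rightarrow> nat set" where
  "val_set M Z = {x. pmass M Z x > 0}"

text \<open>The measure \<open>\<rho>\<^sub>x\<close>.  It is meaningful only for \<open>x \<in> val_set M Z\<close>; see the lemmas below.\<close>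

definition rho :: "'w measure \<Rightarrow> ('w \<Rightarrow> real) \<Rightarrow> nat \<Rightarrow> 'w measure" where
  "rho M Z x = measure_of (space M) (sets M)
     (\<lambda>A. ennreal ((\<integral>\<omega>. indicator A \<omega> * indicator {\<omega>' \<in> space M. Z \<omega>' = real x} \<omega> \<partial>M)
                    / (\<integral>\<omega>. indicator {\<omega>' \<in> space M. Z \<omega>' = real x} \<omega> \<partial>M)))"

lemma rho_eq_uniform_measure:
  assumes "prob_space M" and Z: "Z \<in> borel_measurable M" and "x \<in> val_set M Z"
  shows "rho M Z x = uniform_measure M {\<omega> \<in> space M. Z \<omega> = real x}"
proof -
  interpret prob_space M by fact
  let ?A = "{\<omega> \<in> space M. Z \<omega> = real x}"
  have A: "?A \<in> sets M" using Z by measurable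
  have pos: "measure M ?A > 0" using assms(3) by (simp add: val_set_def pmass_def)
  let ?U = "uniform_measure M ?A"
  have eq: "emeasure ?U B = ennreal ((\<integral>\<omega>. indicator B \<omega> * indicator ?A \<omega> \<partial>M)
       / (\<integral>\<omega>. indicator ?A \<omega> \<partial>M))" if B: "B \<in> sets M" for B
  proof -
    have "(\<integral>\<omega>. indicator B \<omega> * indicator ?A \<omega> \<partial>M) = (\<integral>\<omega>. (indicator (?A \<inter> B) \<omega> :: real) \<partial>M)"
      by (intro Bochner_Integration.integral_cong) (auto simp: indicator_def)
    also have "\<dots> = measure M (?A \<inter> B)" using A B by simp
    finally have 1: "(\<integral>\<omega>. indicator B \<omega> * indicator ?A \<omega> \<partial>M) = measure M (?A \<inter> B)" .
    have 2: "(\<integral>\<omega>. (indicator ?A \<omega> :: real) \<partial>M) = measure M ?A" using A by simp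
    show ?thesis
      using pos by (simp only: emeasure_uniform_measure[OF A B] 1 2)
        (simp add: emeasure_eq_measure divide_ennreal)
  qed
  have "rho M Z x = measure_of (space M) (sets M) (emeasure ?U)"
    unfolding rho_def
    by (rule measure_of_eq[OF sets.space_closed]) (simp add: eq sets.sigma_sets_eq)
  also have "\<dots> = ?U"
    using measure_of_of_measure[of ?U] by simp
  finally show ?thesis .
qed

lemma rho_props:
  assumes "prob_space M" "Z \<in> borel_measurable M" "x \<in> val_set M Z"
  shows "prob_space (rho M Z x)" and "sets (rho M Z x) = sets M"
    and "A \<in> sets M \<Longrightarrow> measure (rho M Z x) A =
       (\<integral>\<omega>. indicator A \<omega> * indicator {\<omega>' \<in> space M. Z \<omega>' = real x} \<omega> \<partial>M)
         / (\<integral>\<omega>. indicator {\<omega>' \<in> space M. Z \<omega>' = real x} \<omega> \<partial>M)"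
proof -
  interpret prob_space M by fact
  let ?A = "{\<omega> \<in> space M. Z \<omega> = real x}"
  have A: "?A \<in> sets M" using assms(2) by measurable
  have pos: "measure M ?A > 0" using assms(3) by (simp add: val_set_def pmass_def)
  note eq = rho_eq_uniform_measure[OF assms]
  show "prob_space (rho M Z x)"
    unfolding eq by (rule prob_space_uniform_measure) (use pos in \<open>auto simp: emeasure_eq_measure\<close>)
  show "sets (rho M Z x) = sets M" by (simp add: eq)
  assume B: "A \<in> sets M"
  have "(\<integral>\<omega>. indicator A \<omega> * indicator ?A \<omega> \<partial>M) = (\<integral>\<omega>. (indicator (?A \<inter> A) \<omega> :: real) \<partial>M)"
    by (intro Bochner_Integration.integral_cong) (auto simp: indicator_def)
  also have "\<dots> = measure M (?A \<inter> A)" using A B by simp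
  finally show "measure (rho M Z x) A =
       (\<integral>\<omega>. indicator A \<omega> * indicator ?A \<omega> \<partial>M) / (\<integral>\<omega>. indicator ?A \<omega> \<partial>M)"
    using A B pos by (simp add: eq measure_uniform_measure emeasure_eq_measure)
qed

text \<open>\<open>claim_pmf K X \<theta> x\<close> is \<open>f\<^sub>\<theta>(x) = P\<^sub>\<theta>(X\<^sub>1 = x)\<close>, so that \<open>f\<close> conditional on \<open>\<Theta>\<close>
  is \<open>\<lambda>\<omega>. claim_pmf K X (\<Theta> \<omega>) x\<close>.\<close>

definition claim_pmf ::
  "('t \<Rightarrow> 'w measure) \<Rightarrow> (nat \<Rightarrow> 'w \<Rightarrow> real) \<Rightarrow> 't \<Rightarrow> nat \<Rightarrow> real" where
  "claim_pmf K X \<theta> x = pmass (K \<theta>) (X 1) x"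

definition rec_coeff :: "'w measure \<Rightarrow> ('w \<Rightarrow> 't) \<Rightarrow> ('t \<Rightarrow> 'w measure) \<Rightarrow> (nat \<Rightarrow> 'w \<Rightarrow> real)
    \<Rightarrow> ('w \<Rightarrow> nat) \<Rightarrow> real \<Rightarrow> real \<Rightarrow> nat \<Rightarrow> nat \<Rightarrow> real" where
  "rec_coeff M \<Theta> K X N a b x y =
     (a + b * (real y / real x)) *
     (\<integral>\<omega>. claim_pmf K X (\<Theta> \<omega>) y / (1 - a * claim_pmf K X (\<Theta> \<omega>) 0)
        \<partial>(rho M (agg_sum X N) (x - y)))"

end

theory Submission
  imports Defs
begin

text \<open>
  Let \<open>F\<^sub>\<theta>\<close> be the generating power series of \<open>f\<^sub>\<theta>\<close>. Conditionally on \<open>\<Theta>\<close>, the probability of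
  \<open>{X\<^sub>1 + \<dots> + X\<^sub>n = x, N = n}\<close> is \<open>P(N = n)\<close> times the coefficient of order \<open>x\<close> of the \<open>n\<close>-th power
  of \<open>F\<^sub>\<Theta>\<close>. Hence, for bounded \<open>h\<close>, the weighted mass \<open>L(x, h) = E[h(\<Theta>); S = x]\<close> is a series over
  \<open>n\<close>, and Panjer's relation together with the derivative of a power of \<open>F\<^sub>\<theta>\<close> gives
  \<open>L(x, h) = (\<Sum>y=0..x. (a + b y/x) L(x - y, h f(y)))\<close> for \<open>x > 0\<close>. Choosing
  \<open>h = 1 / (1 - a f(0))\<close> absorbs the term \<open>y = 0\<close> into the left-hand side, which becomes
  \<open>P(S = x)\<close>. This \<open>h\<close> is bounded because a Panjer distribution not concentrated at 0 has \<open>a < 1\<close>.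
\<close>

section \<open>Power series coefficients and Panjer sequences\<close>

text \<open>The \<open>b\<close>-part compares coefficients in \<open>X (F\<^sup>n\<^sup>+\<^sup>1)' = (n + 1) (X F') F\<^sup>n\<close>.\<close>

lemma fps_nth_power_Suc_weighted:
  fixes F :: "real fps"
  assumes "x > 0"
  shows "(a + b / real (Suc n)) * fps_nth (F ^ Suc n) x =
    (\<Sum>y=0..x. (a + b * (real y / real x)) * (fps_nth F y * fps_nth (F ^ n) (x - y)))"
proof -
  have F: "fps_nth (F ^ Suc n) x = (\<Sum>y=0..x. fps_nth F y * fps_nth (F ^ n) (x - y))"
    by (simp add: fps_mult_nth)
  \<comment> \<open>The operator \<open>fps_X * fps_deriv\<close> multiplies the coefficient of
    order \<open>k\<close> by \<open>k\<close>; the factor \<open>fps_X\<close> undoes the index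
    shift of the derivative.\<close>
  have X: "fps_nth (fps_X * fps_deriv G) k = real k * fps_nth G k" for G :: "real fps" and k
    by (cases k) auto
  have "fps_X * fps_deriv (F ^ Suc n) = fps_const (real (Suc n)) * ((fps_X * fps_deriv F) * F ^ n)"
    by (simp only: fps_deriv_power diff_Suc_1 fps_of_nat) (simp add: algebra_simps fps_of_nat)
  from arg_cong[OF this, of "\<lambda>G. fps_nth G x"]
  have "real x * fps_nth (F ^ Suc n) x =
      real (Suc n) * (\<Sum>y=0..x. (real y * fps_nth F y) * fps_nth (F ^ n) (x - y))"
    by (simp only: X fps_mult_left_const_nth fps_mult_nth[of "fps_X * fps_deriv F"])
  then have "b / real (Suc n) * fps_nth (F ^ Suc n) x =
      b / real x * (\<Sum>y=0..x. (real y * fps_nth F y) * fps_nth (F ^ n) (x - y))"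
    using assms by (simp add: field_simps del: power_Suc of_nat_Suc)
  then show ?thesis
    by (simp only: distrib_right F sum_distrib_left sum.distrib) (simp add: mult_ac)
qed

text \<open>If \<open>a \<ge> 1\<close> and \<open>p 1 > 0\<close>, then \<open>n p n\<close> is nondecreasing, so \<open>p\<close> dominates a multiple of the
  harmonic series.\<close>

lemma Panjer_coefficient_less_1:
  fixes p :: "nat \<Rightarrow> real"
  assumes rec: "\<And>n. n \<ge> 1 \<Longrightarrow> p n = (a + b / real n) * p (n - 1)"
    and nonneg: "\<And>n. p n \<ge> 0" and "summable p" and k: "k \<ge> 1" "p k \<noteq> 0"
  shows "a < 1"
proof (rule ccontr)
  assume "\<not> a < 1"
  \<comment> \<open>If \<open>p 1\<close> were 0, the recursion would propagate 0 to all later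
    terms, contradicting \<open>p k \<noteq> 0\<close>.\<close>
  have zero: "p (Suc n) = 0" if "p 1 = 0" for n
    by (induction n) (use that rec[of "Suc _"] in auto)
  have p1: "p 1 > 0"
    using zero[of "k - 1"] k nonneg[of 1] by force
  moreover have "p 1 = (a + b) * p 0" using rec[of 1] by simp
  ultimately have "a + b > 0" using nonneg[of 0] by (metis zero_less_mult_pos2 less_eq_real_def mult_zero_right)
  have grow: "p 1 \<le> real (Suc n) * p (Suc n)" for n
  proof (induction n)
    case (Suc n)
    \<comment> \<open>The right-hand side is \<open>a * real (Suc n) + (a + b)\<close>, where
      \<open>a \<ge> 1\<close> and \<open>a + b > 0\<close>.\<close>
    have "real (Suc n) \<le> a * real (Suc (Suc n)) + b"
      using mult_right_mono[of 1 a "real (Suc n)"] \<open>\<not> a < 1\<close> \<open>a + b > 0\<close>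
      by (simp add: algebra_simps)
    then have "real (Suc n) * p (Suc n) \<le> (a * real (Suc (Suc n)) + b) * p (Suc n)"
      by (intro mult_right_mono nonneg)
    also have "\<dots> = real (Suc (Suc n)) * p (Suc (Suc n))"
      using rec[of "Suc (Suc n)"] by (simp add: field_simps)
    finally show ?case using Suc by simp
  qed simp
  have "summable (\<lambda>n. p 1 * inverse (real (Suc n)))"
  proof (rule summable_comparison_test'[where N = 0])
    show "summable (\<lambda>n. p (Suc n))" using \<open>summable p\<close> by (simp add: summable_Suc_iff)
  qed (use grow p1 in \<open>auto simp: field_simps\<close>)
  then have "summable (\<lambda>n. inverse (real (Suc n)))" 
    using p1 by simp
  then show False
    using not_summable_harmonic[where ?'a = real] summable_Suc_iff[of "\<lambda>n. inverse (real n)"]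
    by (simp add: inverse_eq_divide)
qed

section \<open>Series of integrals and conditioning on an event\<close>

lemma sum_in_Nats:
  assumes "\<And>i. i \<in> A \<Longrightarrow> g i \<in> \<nat>"
  shows "sum g A \<in> (\<nat> :: 'a :: semiring_1 set)"
  using assms by (induction A rule: infinite_finite_induct) auto

text \<open>The \<open>n\<close>-th integral of the absolute value is at most
  \<open>\<bar>c\<bar> * measure M (A n)\<close>, and these bounds are summable because the
  \<open>A n\<close> are disjoint in a finite measure space; so sum and integral may be
  exchanged.\<close>

lemma (in finite_measure) sums_integral_disjoint:
  fixes g :: "'a \<Rightarrow> real"
  assumes A: "\<And>n::nat. A n \<in> sets M" "disjoint_family A" and g: "g \<in> borel_measurable M"
    and bd: "\<And>\<omega>. \<omega> \<in> space M \<Longrightarrow> \<bar>g \<omega>\<bar> \<le> c"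
  shows "(\<lambda>n. \<integral>\<omega>. g \<omega> * indicator (A n) \<omega> \<partial>M) sums (\<integral>\<omega>. g \<omega> * indicator (\<Union>n. A n) \<omega> \<partial>M)"
proof -
  let ?f = "\<lambda>n \<omega>. g \<omega> * indicator (A n) \<omega>"
  have point: "(\<lambda>n. k * indicator (A n) \<omega>) sums (k * indicator (\<Union>n. A n) \<omega>)" for k :: real and \<omega>
  proof (cases "\<omega> \<in> (\<Union>n. A n)")
    case True
    then obtain m where m: "\<omega> \<in> A m" by auto
    have "(\<lambda>n. k * indicator (A n) \<omega>) = (\<lambda>n. if n = m then k else 0)"
      using m A(2) by (intro ext) (auto simp: disjoint_family_on_def indicator_def)
    then show ?thesis using True sums_single[of m "\<lambda>_. k"] by simp
  qed auto
  \<comment> \<open>Off \<open>A n\<close> the integrand is 0, so the bound has to be nonnegative;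
    \<open>bd\<close> forces \<open>c \<ge> 0\<close> only on a nonempty space, hence
    \<open>\<bar>c\<bar>\<close>.\<close>
  have int: "integrable M (?f n)" for n
    by (rule integrable_const_bound[where B = "\<bar>c\<bar>"])
       (use A g in \<open>auto simp: indicator_def intro!: order_trans[OF bd]\<close>)
  have "(\<lambda>n. integral\<^sup>L M (?f n)) sums (\<integral>\<omega>. (\<Sum>n. ?f n \<omega>) \<partial>M)"
  proof (rule sums_integral[OF int])
    show "AE \<omega> in M. summable (\<lambda>n. norm (?f n \<omega>))"
      using point by (auto simp: abs_mult sums_iff)
    have le: "(\<integral>\<omega>. norm (?f n \<omega>) \<partial>M) \<le> \<bar>c\<bar> * measure M (A n)" for n
    proof -
      have "(\<integral>\<omega>. norm (?f n \<omega>) \<partial>M) \<le> (\<integral>\<omega>. \<bar>c\<bar> * indicator (A n) \<omega> \<partial>M)"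
        using A by (intro integral_mono integrable_norm int)
          (auto simp: abs_mult less_top[symmetric] intro!: mult_right_mono order_trans[OF bd] integrable_mult_right)
      then show ?thesis using A by simp
    qed
    have "summable (\<lambda>n. measure M (A n))"
      using finite_measure_UNION[of A] A by (auto simp: sums_iff)
    then have "summable (\<lambda>n. \<bar>c\<bar> * measure M (A n))" by (rule summable_mult)
    then show "summable (\<lambda>n. \<integral>\<omega>. norm (?f n \<omega>) \<partial>M)"
    proof (rule summable_comparison_test'[where N = 0])
      show "norm (\<integral>\<omega>. norm (?f n \<omega>) \<partial>M) \<le> \<bar>c\<bar> * measure M (A n)" for n
        using le[of n] by (subst real_norm_def, subst abs_of_nonneg) (rule integral_nonneg_AE, simp_all)
    qed
  qed
  then show ?thesis using point by (simp add: sums_iff)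
qed

text \<open>Once the extended nonnegative density is rewritten as a real quotient,
  \<open>integral_density\<close> applies. This turns an expectation under \<open>rho\<close> into
  an integral over an event of the form \<open>S = x\<close>.\<close>

lemma integral_uniform_measure:
  fixes f :: "'a \<Rightarrow> real"
  assumes A: "A \<in> sets M" "emeasure M A \<noteq> \<infinity>" "emeasure M A \<noteq> 0" and f: "f \<in> borel_measurable M"
  shows "(\<integral>\<omega>. f \<omega> \<partial>uniform_measure M A) = (\<integral>\<omega>. f \<omega> * indicator A \<omega> \<partial>M) / measure M A"
proof -
  have "uniform_measure M A = density M (\<lambda>\<omega>. ennreal (indicator A \<omega> / measure M A))"
    unfolding uniform_measure_def
  proof (rule density_cong)
    have eq: "emeasure M A = ennreal (measure M A)"
      using A by (intro emeasure_eq_ennreal_measure) simp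
    then have pos: "measure M A > 0"
      using A(3) by (metis ennreal_0 measure_nonneg order_less_le)
    show "AE \<omega> in M. indicator A \<omega> / emeasure M A = ennreal (indicator A \<omega> / measure M A)"
    proof (rule AE_I2)
      fix \<omega>
      have "ennreal (indicator A \<omega> / measure M A) = ennreal (indicator A \<omega>) / ennreal (measure M A)"
        using pos by (simp add: divide_ennreal)
      then show "indicator A \<omega> / emeasure M A = ennreal (indicator A \<omega> / measure M A)"
        by (simp add: eq ennreal_indicator)
    qed
  qed (use A in measurable)
  then have "(\<integral>\<omega>. f \<omega> \<partial>uniform_measure M A) = (\<integral>\<omega>. (indicator A \<omega> / measure M A) *\<^sub>R f \<omega> \<partial>M)"
    using A f by (simp add: integral_density)
  also have "\<dots> = (\<integral>\<omega>. (f \<omega> * indicator A \<omega>) / measure M A \<partial>M)"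
    by (simp add: mult_ac)
  finally show ?thesis by simp
qed

text \<open>The integrand vanishes off the null set \<open>A\<close>. This serves the values outside
  \<open>val_set\<close>, where the convention reads the term as 0.\<close>

lemma (in finite_measure) integral_mult_indicator_null:
  assumes "A \<in> sets M" "measure M A = 0"
  shows "(\<integral>\<omega>. f \<omega> * indicator A \<omega> \<partial>M) = (0 :: real)"
proof -
  have "AE \<omega> in M. \<omega> \<notin> A"
    using assms by (intro AE_not_in) (auto simp: null_sets_def emeasure_eq_measure)
  then have "AE \<omega> in M. f \<omega> * indicator A \<omega> = 0"
    by eventually_elim simp
  then show ?thesis by (rule integral_eq_zero_AE)
qed

section \<open>The conditional model and probabilities conditional on \<Theta>\<close>

locale conditional_iid_claims = prob_space M for M :: "'w measure" +
  fixes T :: "'t measure" and \<Theta> :: "'w \<Rightarrow> 't" and K :: "'t \<Rightarrow> 'w measure"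
    and N :: "'w \<Rightarrow> nat" and X :: "nat \<Rightarrow> 'w \<Rightarrow> real"
  assumes measurable_Theta [measurable]: "\<Theta> \<in> measurable M T"
    and measurable_N [measurable]: "N \<in> measurable M (count_space UNIV)"
    and measurable_X: "\<And>n. n \<ge> 1 \<Longrightarrow> X n \<in> borel_measurable M"
    and rcp: "consistent_rcp M T \<Theta> K"
    and iid: "cond_iid M (gen_alg M T \<Theta>) X"
    and cond_indep: "cond_indep_sets M (gen_alg M T \<Theta>)
           (seq_events M X) (sets (gen_alg M (count_space UNIV) N))"
    and nat_valued: "measure (distr M borel (X 1)) \<nat> = 1"
    and indep_N: "indep_set (sets (gen_alg M (count_space UNIV) N)) (sets (gen_alg M T \<Theta>))"
begin

abbreviation "F \<equiv> gen_alg M T \<Theta>"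

abbreviation "claim_fps \<theta> \<equiv> Abs_fps (claim_pmf K X \<theta>)"

lemma Theta_space: "\<omega> \<in> space M \<Longrightarrow> \<Theta> \<omega> \<in> space T"
  using measurable_Theta by (rule measurable_space)

lemma sets_F: "sets F = {\<Theta> -` B \<inter> space M | B. B \<in> sets T}"
  unfolding gen_alg_def using Theta_space by (intro sets_vimage_algebra2) auto

lemma space_F [simp]: "space F = space M"
  by (simp add: gen_alg_def)

lemma measurable_Theta_F [measurable]: "\<Theta> \<in> measurable F T"
  unfolding gen_alg_def using Theta_space by (intro measurable_vimage_algebra1) auto

sublocale cond: finite_measure_subalgebra M F
  by unfold_locales (auto simp: subalgebra_def sets_F)

text \<open>Uniqueness of conditional expectations: a version is determined by its integrals over
  the events of \<open>F\<close>. The kernel, the common law of the claims and the law of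
  \<open>N\<close> are all recognized as versions in this way.\<close>

lemma cprob_eqI:
  assumes A: "A \<in> events" and q: "integrable M q" "q \<in> borel_measurable F"
    and eq: "\<And>E. E \<in> sets F \<Longrightarrow> (\<integral>\<omega>\<in>E. q \<omega> \<partial>M) = measure M (E \<inter> A)"
  shows "AE \<omega> in M. cprob M F A \<omega> = q \<omega>"
  unfolding cprob_def
proof (rule cond.real_cond_exp_charact)
  fix E assume E: "E \<in> sets F"
  then have "E \<in> events" using cond.subalg by (auto simp: subalgebra_def)
  then have "(\<integral>\<omega>\<in>E. indicator A \<omega> \<partial>M) = measure M (E \<inter> A)"
    using A by (simp add: set_lebesgue_integral_def flip: indicator_inter_arith)
  then show "(\<integral>\<omega>\<in>E. indicator A \<omega> \<partial>M) = (\<integral>\<omega>\<in>E. q \<omega> \<partial>M)"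
    by (simp add: eq[OF E])
qed (use A q in \<open>auto simp: less_top[symmetric]\<close>)

lemma integral_cprob_F:
  assumes "A \<in> events" "E \<in> sets F"
  shows "(\<integral>\<omega>\<in>E. cprob M F A \<omega> \<partial>M) = measure M (E \<inter> A)"
proof -
  have "E \<in> events" using assms cond.subalg by (auto simp: subalgebra_def)
  have "(\<integral>\<omega>\<in>E. cprob M F A \<omega> \<partial>M) = (\<integral>\<omega>\<in>E. indicator A \<omega> \<partial>M)"
    unfolding cprob_def using assms
    by (intro cond.real_cond_exp_intA[symmetric]) (auto simp: less_top[symmetric])
  also have "\<dots> = measure M (E \<inter> A)"
    using \<open>E \<in> events\<close> assms by (simp add: set_lebesgue_integral_def flip: indicator_inter_arith)
  finally show ?thesis .
qed

lemma integrable_cprob: "A \<in> events \<Longrightarrow> integrable M (cprob M F A)"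
  unfolding cprob_def by (rule cond.real_cond_exp_int) (auto simp: less_top[symmetric])

lemma measurable_cprob [measurable]: "cprob M F A \<in> borel_measurable F"
  unfolding cprob_def by simp

lemma cprob_cong:
  assumes "AE \<omega> in M. \<omega> \<in> A \<longleftrightarrow> \<omega> \<in> B" "A \<in> events" "B \<in> events"
  shows "AE \<omega> in M. cprob M F A \<omega> = cprob M F B \<omega>"
  unfolding cprob_def
  by (rule cond.real_cond_exp_cong) (use assms in \<open>auto simp: indicator_def elim!: AE_mp\<close>)

lemma cprob_Diff:
  assumes "A \<in> events" "B \<in> events" "B \<subseteq> A"
  shows "AE \<omega> in M. cprob M F (A - B) \<omega> = cprob M F A \<omega> - cprob M F B \<omega>"
proof -
  have "(indicator (A - B) :: _ \<Rightarrow> real) = (\<lambda>\<omega>. indicator A \<omega> - indicator B \<omega>)"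
    using assms(3) by (auto simp: indicator_def fun_eq_iff)
  then show ?thesis
    unfolding cprob_def using assms
    by (simp only:) (rule cond.real_cond_exp_diff; auto simp: less_top[symmetric])
qed

lemma cprob_UN_disjoint:
  assumes "\<And>i. A i \<in> events" "disjoint_family_on A I" "finite I"
  shows "AE \<omega> in M. cprob M F (\<Union>i\<in>I. A i) \<omega> = (\<Sum>i\<in>I. cprob M F (A i) \<omega>)"
proof -
  have "(indicator (\<Union>i\<in>I. A i) :: _ \<Rightarrow> real) = (\<lambda>\<omega>. \<Sum>i\<in>I. indicator (A i) \<omega>)"
    using assms(2,3) by (auto simp: fun_eq_iff indicator_UN_disjoint)
  then show ?thesis
    unfolding cprob_def using assms
    by (simp only:) (rule cond.real_cond_exp_sum; auto simp: less_top[symmetric])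
qed

lemma cprob_space: "AE \<omega> in M. cprob M F (space M) \<omega> = 1"
proof (rule cprob_eqI)
  fix E assume "E \<in> sets F"
  then have "E \<in> events" using cond.subalg by (auto simp: subalgebra_def)
  then show "(\<integral>\<omega>\<in>E. 1 \<partial>M) = measure M (E \<inter> space M)"
    by (simp add: set_lebesgue_integral_def)
qed auto

lemma cprob_empty: "AE \<omega> in M. cprob M F {} \<omega> = 0"
  by (rule cprob_eqI) (auto simp: set_lebesgue_integral_def)

text \<open>A bounded function of \<Theta> is \<open>F\<close>-measurable and can be pulled out of
  the conditional expectation. Almost sure identities for \<open>cprob\<close> become identities of
  weighted integrals through this.\<close>

lemma integral_mult_cprob:
  assumes A: "A \<in> events" and h: "h \<in> borel_measurable T"
    and bd: "\<And>\<omega>. \<omega> \<in> space M \<Longrightarrow> \<bar>h (\<Theta> \<omega>)\<bar> \<le> c"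
  shows "(\<integral>\<omega>. h (\<Theta> \<omega>) * cprob M F A \<omega> \<partial>M) = (\<integral>\<omega>. h (\<Theta> \<omega>) * indicator A \<omega> \<partial>M)"
  unfolding cprob_def
proof (rule cond.real_cond_exp_intg)
  show "integrable M (\<lambda>\<omega>. h (\<Theta> \<omega>) * indicator A \<omega>)"
    by (rule integrable_const_bound[where B = "\<bar>c\<bar>"])
       (use assms in \<open>auto simp: indicator_def intro!: order_trans[OF bd]\<close>)
  show "(\<lambda>\<omega>. h (\<Theta> \<omega>)) \<in> borel_measurable F"
    using h by measurable
qed (use A in auto)

section \<open>The kernel as a version of the conditional probability\<close>

lemma measurable_kernel [measurable]:
  "E \<in> events \<Longrightarrow> (\<lambda>\<theta>. measure (K \<theta>) E) \<in> borel_measurable T"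
  using rcp by (auto simp: consistent_rcp_def)

lemma kernel:
  assumes "\<theta> \<in> space T"
  shows prob_space_kernel: "prob_space (K \<theta>)" and sets_kernel: "sets (K \<theta>) = events"
    and space_kernel: "space (K \<theta>) = space M"
proof -
  show "prob_space (K \<theta>)" and *: "sets (K \<theta>) = events"
    using rcp assms by (auto simp: consistent_rcp_def)
  show "space (K \<theta>) = space M" using * by (rule sets_eq_imp_space_eq)
qed

lemma cprob_kernel:
  assumes E: "E \<in> events"
  shows "AE \<omega> in M. cprob M F E \<omega> = measure (K (\<Theta> \<omega>)) E"
proof (rule cprob_eqI[OF E])
  show "integrable M (\<lambda>\<omega>. measure (K (\<Theta> \<omega>)) E)"
    by (rule integrable_const_bound[where B = 1])
       (use E in \<open>auto intro!: AE_I2 prob_space.prob_le_1 prob_space_kernel Theta_space\<close>)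
  show "(\<lambda>\<omega>. measure (K (\<Theta> \<omega>)) E) \<in> borel_measurable F"
    using E by measurable
  fix A assume "A \<in> sets F"
  then obtain B where B: "B \<in> sets T" and A: "A = \<Theta> -` B \<inter> space M"
    by (auto simp: sets_F)
  have ev: "A \<in> events" using B unfolding A by measurable
  let ?Q = "distr M T \<Theta>"
  have "AE \<theta> in ?Q. \<theta> \<in> B \<longrightarrow> measure (K \<theta>) A = 1"
    using rcp B unfolding consistent_rcp_def A by blast
  \<comment> \<open>Consistency for the complement of \<open>B\<close> supplies the other half:
    \<open>A\<close> has kernel mass 0 when \<theta> lies outside \<open>B\<close>.\<close>
  moreover have "AE \<theta> in ?Q. \<theta> \<in> space T - B \<longrightarrow>
      measure (K \<theta>) (\<Theta> -` (space T - B) \<inter> space M) = 1"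
    using rcp B unfolding consistent_rcp_def by blast
  moreover have "AE \<theta> in ?Q. \<theta> \<in> space T"
    using AE_space[of ?Q] by simp
  ultimately have ae: "AE \<theta> in ?Q. measure (K \<theta>) (A \<inter> E) = indicator B \<theta> * measure (K \<theta>) E"
  proof eventually_elim
    fix \<theta> assume *: "\<theta> \<in> B \<longrightarrow> measure (K \<theta>) A = 1"
      "\<theta> \<in> space T - B \<longrightarrow> measure (K \<theta>) (\<Theta> -` (space T - B) \<inter> space M) = 1"
      "\<theta> \<in> space T"
    interpret K: prob_space "K \<theta>" by (rule prob_space_kernel) fact
    note [simp] = sets_kernel[OF *(3)] space_kernel[OF *(3)]
    show "measure (K \<theta>) (A \<inter> E) = indicator B \<theta> * measure (K \<theta>) E"
    proof (cases "\<theta> \<in> B")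
      case True
      then have "AE \<omega> in K \<theta>. \<omega> \<in> A" using *(1) ev by (subst K.prob_eq_1[symmetric]) auto
      then have "measure (K \<theta>) (A \<inter> E) = measure (K \<theta>) E"
        by (intro K.finite_measure_eq_AE) (use ev E in auto)
      then show ?thesis using True by simp
    next
      case False
      have "\<Theta> -` (space T - B) \<inter> space M = space M - A"
        using Theta_space by (auto simp: A)
      then have "measure (K \<theta>) A = 0" using *(2,3) False ev K.prob_compl[of A] by simp
      then have "measure (K \<theta>) (A \<inter> E) = 0"
        using K.finite_measure_mono[of "A \<inter> E" A] ev by (simp add: measure_le_0_iff)
      then show ?thesis using False by simp
    qed
  qed
  have "(\<integral>\<omega>\<in>A. measure (K (\<Theta> \<omega>)) E \<partial>M) = (\<integral>\<omega>. indicator B (\<Theta> \<omega>) * measure (K (\<Theta> \<omega>)) E \<partial>M)"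
    unfolding set_lebesgue_integral_def A
    by (intro Bochner_Integration.integral_cong) (auto simp: indicator_def)
  also have "\<dots> = (\<integral>\<theta>. indicator B \<theta> * measure (K \<theta>) E \<partial>?Q)"
    using B E by (subst integral_distr) auto
  also have "\<dots> = (\<integral>\<theta>. measure (K \<theta>) (A \<inter> E) \<partial>?Q)"
    using ae B E ev by (intro integral_cong_AE) auto
  also have "\<dots> = measure M (A \<inter> E)"
    using rcp ev E by (auto simp: consistent_rcp_def)
  finally show "(\<integral>\<omega>\<in>A. measure (K (\<Theta> \<omega>)) E \<partial>M) = measure M (A \<inter> E)" .
qed

section \<open>The law of a single claim given \<Theta>\<close>

lemma claim_vimage_eq: "X n -` B \<inter> space M = {\<omega> \<in> space M. X n \<omega> \<in> B}"
  by auto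

lemma claim_event: "n \<ge> 1 \<Longrightarrow> B \<in> sets borel \<Longrightarrow> {\<omega> \<in> space M. X n \<omega> \<in> B} \<in> events"
  using measurable_sets[OF measurable_X, of n B] by (simp only: claim_vimage_eq)

lemma claim_pmf_eq:
  "\<theta> \<in> space T \<Longrightarrow> claim_pmf K X \<theta> y = measure (K \<theta>) {\<omega> \<in> space M. X 1 \<omega> = real y}"
  by (simp add: claim_pmf_def pmass_def space_kernel)

lemma measurable_claim_pmf [measurable]: "(\<lambda>\<theta>. claim_pmf K X \<theta> y) \<in> borel_measurable T"
proof -
  have "(\<lambda>\<theta>. measure (K \<theta>) {\<omega> \<in> space M. X 1 \<omega> = real y}) \<in> borel_measurable T"
    using claim_event[of 1 "{real y}"] by (intro measurable_kernel) simp
  then show ?thesis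
    by (simp add: claim_pmf_eq cong: measurable_cong)
qed

lemma claim_pmf_bounds:
  assumes "\<theta> \<in> space T"
  shows "0 \<le> claim_pmf K X \<theta> y" "claim_pmf K X \<theta> y \<le> 1"
  by (simp_all add: claim_pmf_eq[OF assms] prob_space.prob_le_1[OF prob_space_kernel[OF assms]])

lemma cprob_claim_pmf:
  "AE \<omega> in M. cprob M F {\<omega> \<in> space M. X 1 \<omega> = real y} \<omega> = claim_pmf K X (\<Theta> \<omega>) y"
proof -
  have "AE \<omega> in M. cprob M F {\<omega> \<in> space M. X 1 \<omega> = real y} \<omega> =
      measure (K (\<Theta> \<omega>)) {\<omega> \<in> space M. X 1 \<omega> = real y}"
    using claim_event[of 1 "{real y}"] by (intro cprob_kernel) auto
  then show ?thesis
    using AE_space by eventually_elim (simp add: claim_pmf_eq Theta_space)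
qed

lemma claim_ident:
  assumes "k \<ge> 1" "B \<in> sets borel" "E \<in> sets F"
  shows "measure M (E \<inter> {\<omega> \<in> space M. X k \<omega> \<in> B}) = measure M (E \<inter> {\<omega> \<in> space M. X 1 \<omega> \<in> B})"
proof -
  have "\<forall>k\<ge>1. \<forall>m\<ge>1. \<forall>E\<in>sets F. \<forall>B\<in>sets borel.
      measure M (E \<inter> (X k -` B \<inter> space M)) = measure M (E \<inter> (X m -` B \<inter> space M))"
    using iid unfolding cond_iid_def by (rule conjunct2)
  from this[rule_format, OF assms(1) order_refl assms(3,2)] show ?thesis
    by (simp only: claim_vimage_eq)
qed

text \<open>Each claim has the same joint law with \<Theta>, so the integrals over events of
  \<open>F\<close> agree and \<open>cprob_eqI\<close> applies.\<close>

lemma cprob_claim_ident: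
  assumes "k \<ge> 1" "B \<in> sets borel"
  shows "AE \<omega> in M. cprob M F {\<omega> \<in> space M. X k \<omega> \<in> B} \<omega> = cprob M F {\<omega> \<in> space M. X 1 \<omega> \<in> B} \<omega>"
proof (rule cprob_eqI)
  show "(\<integral>\<omega>\<in>E. cprob M F {\<omega> \<in> space M. X 1 \<omega> \<in> B} \<omega> \<partial>M) =
      measure M (E \<inter> {\<omega> \<in> space M. X k \<omega> \<in> B})" if "E \<in> sets F" for E
    using claim_ident[OF assms that] integral_cprob_F[OF claim_event[OF order_refl assms(2)] that]
    by simp
qed (use assms in \<open>simp_all add: claim_event integrable_cprob\<close>)

lemma Nats_borel: "(\<nat> :: real set) \<in> sets borel"
  by (simp add: borel_closed)

text \<open>Integrality is assumed for \<open>X 1\<close> only; identical distribution, taken with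
  the whole space as the event of \<open>F\<close>, carries it to every \<open>X k\<close>.
  Countably many indices share one null set.\<close>

lemma AE_claim_Nats: "AE \<omega> in M. \<forall>k\<ge>1. X k \<omega> \<in> \<nat>"
proof -
  have "AE \<omega> in M. X k \<omega> \<in> \<nat>" if k: "k \<ge> 1" for k
  proof -
    have "space M \<inter> {\<omega> \<in> space M. X i \<omega> \<in> \<nat>} = {\<omega> \<in> space M. X i \<omega> \<in> \<nat>}" for i
      by auto
    with claim_ident[OF k Nats_borel sets.top]
    have "measure M {\<omega> \<in> space M. X k \<omega> \<in> \<nat>} = measure M {\<omega> \<in> space M. X 1 \<omega> \<in> \<nat>}"
      by (simp only: space_F)
    also have "\<dots> = measure (distr M borel (X 1)) \<nat>"
      using measurable_X[of 1] Nats_borel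
      by (subst measure_distr) (auto intro!: arg_cong[where f = "measure M"])
    also note nat_valued
    finally show ?thesis
      using prob_eq_1[OF claim_event[OF k Nats_borel]] by auto
  qed
  then show ?thesis by (simp add: AE_all_countable)
qed

section \<open>Partial sums of claims given \<Theta>\<close>

lemma measurable_partial_sum [measurable]: "(\<lambda>\<omega>. \<Sum>j=1..n. X j \<omega>) \<in> borel_measurable M"
  by (intro borel_measurable_sum measurable_X) auto

lemma partial_sum_event: "{\<omega> \<in> space M. (\<Sum>j=1..n. X j \<omega>) = c} \<in> events"
  by measurable

lemma measurable_claim_fps_power [measurable]:
  "(\<lambda>\<theta>. fps_nth (claim_fps \<theta> ^ n) x) \<in> borel_measurable T"
proof (induction n arbitrary: x)
  case 0
  then show ?case by simp
next
  case (Suc n)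
  note [measurable] = Suc
  show ?case unfolding power_Suc fps_mult_nth fps_nth_Abs_fps by measurable
qed

text \<open>The only natural number in the interval from \<open>real y - 1\<close> (excluded) to
  \<open>real y\<close> (included) is \<open>y\<close>, also for \<open>y = 0\<close>. For almost
  surely integral claims the mass at \<open>y\<close> is therefore a difference of two half-line
  probabilities.\<close>

lemma cprob_claim_interval:
  assumes k: "k \<ge> 1"
  shows "AE \<omega> in M. cprob M F {\<omega> \<in> space M. X k \<omega> \<le> real y} \<omega>
      - cprob M F {\<omega> \<in> space M. X k \<omega> \<le> real y - 1} \<omega> = claim_pmf K X (\<Theta> \<omega>) y"
proof -
  let ?A = "\<lambda>k c. {\<omega> \<in> space M. X k \<omega> \<le> c}"
  have ev: "?A k c \<in> events" for c using claim_event[of k "{..c}"] k by simp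
  have I: "?A k (real y) - ?A k (real y - 1) = {\<omega> \<in> space M. X k \<omega> \<in> {real y - 1<..real y}}"
    by auto
  have "AE \<omega> in M. cprob M F (?A k (real y) - ?A k (real y - 1)) \<omega>
      = cprob M F (?A k (real y)) \<omega> - cprob M F (?A k (real y - 1)) \<omega>"
    by (intro cprob_Diff ev) auto
  moreover have "AE \<omega> in M. cprob M F (?A k (real y) - ?A k (real y - 1)) \<omega> =
      cprob M F {\<omega> \<in> space M. X 1 \<omega> \<in> {real y - 1<..real y}} \<omega>"
    unfolding I using k by (rule cprob_claim_ident) simp
  moreover have "AE \<omega> in M. cprob M F {\<omega> \<in> space M. X 1 \<omega> \<in> {real y - 1<..real y}} \<omega> =
      cprob M F {\<omega> \<in> space M. X 1 \<omega> = real y} \<omega>"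
  proof (rule cprob_cong)
    show "AE \<omega> in M. \<omega> \<in> {\<omega> \<in> space M. X 1 \<omega> \<in> {real y - 1<..real y}} \<longleftrightarrow>
        \<omega> \<in> {\<omega> \<in> space M. X 1 \<omega> = real y}"
      using AE_claim_Nats
    proof eventually_elim
      case (elim \<omega>)
      then obtain m where "X 1 \<omega> = real m" by (auto elim: Nats_cases)
      then show ?case by auto
    qed
  qed (use claim_event[of 1 "{real y}"] claim_event[of 1 "{real y - 1<..real y}"] in auto)
  moreover note cprob_claim_pmf
  ultimately show ?thesis by eventually_elim simp
qed

text \<open>Conditional independence is only given for half-lines, so the claims not yet
  summed are carried along in that form; the event \<open>X\<^sub>n\<^sub>+\<^sub>1 = y\<close> is then split off as a difference
  of two half-line events.\<close>

lemma cprob_partial_sum_joint: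
  assumes "finite J" "J \<subseteq> {Suc n..}"
  shows "AE \<omega> in M.
    cprob M F {\<omega> \<in> space M. (\<Sum>j=1..n. X j \<omega>) = real x \<and> (\<forall>i\<in>J. X i \<omega> \<le> z i)} \<omega> =
    fps_nth (claim_fps (\<Theta> \<omega>) ^ n) x * (\<Prod>i\<in>J. cprob M F {\<omega> \<in> space M. X i \<omega> \<le> z i} \<omega>)"
  using assms
proof (induction n arbitrary: x J z)
  case 0
  \<comment> \<open>The empty sum is 0 and the zeroth power is 1, so \<open>x \<noteq> 0\<close>
    gives 0 on both sides. The conditional independence hypothesis speaks of nonempty index sets,
    hence the separate case \<open>J = {}\<close>.\<close>
  consider "x \<noteq> 0" | "x = 0" "J = {}" | "x = 0" "J \<noteq> {}" by auto
  then show ?case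
  proof cases
    case 1
    then show ?thesis using cprob_empty by (simp add: fps_one_nth)
  next
    case 2
    then show ?thesis using cprob_space by simp
  next
    case 3
    have "AE \<omega> in M. cprob M F {\<omega> \<in> space M. \<forall>i\<in>J. X i \<omega> \<le> z i} \<omega> =
        (\<Prod>i\<in>J. cprob M F {\<omega> \<in> space M. X i \<omega> \<le> z i} \<omega>)"
      using iid 0 3 unfolding cond_iid_def by auto
    with 3 show ?thesis by simp
  qed
next
  case (Suc n)
  let ?k = "Suc n"
  \<comment> \<open>Replacing \<open>z\<close> at \<open>Suc n\<close> by \<open>c\<close> treats
    the next claim as one more half-line constraint, so the induction hypothesis applies with
    \<open>insert ?k J\<close>. The truncated subtraction \<open>x - y\<close> is harmless, as only
    \<open>y \<le> x\<close> enters the decomposition of \<open>A\<close>.\<close>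
  define B where "B y c = {\<omega> \<in> space M. (\<Sum>j=1..n. X j \<omega>) = real (x - y) \<and>
      (\<forall>i\<in>insert ?k J. X i \<omega> \<le> (z(?k := c)) i)}" for y c
  define A where "A = {\<omega> \<in> space M. (\<Sum>j=1..?k. X j \<omega>) = real x \<and> (\<forall>i\<in>J. X i \<omega> \<le> z i)}"
  have k: "?k \<notin> J" "finite J" "J \<subseteq> {Suc n..}" "\<And>i. i \<in> insert ?k J \<Longrightarrow> i \<ge> 1"
    using Suc.prems by auto
  have half_line: "{\<omega> \<in> space M. X i \<omega> \<le> c} \<in> events" if "i \<ge> 1" for i c
    using claim_event[OF that, of "{..c}"] by simp
  have Bev: "B y c \<in> events" for y c
    unfolding B_def using k(2,4) half_line
    by (intro sets.sets_Collect_conj sets.sets_Collect_finite_All partial_sum_event) blast+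
  have Aev: "A \<in> events"
    unfolding A_def using k(2,4) half_line
    by (intro sets.sets_Collect_conj sets.sets_Collect_finite_All partial_sum_event) blast+
  have B_iff: "\<omega> \<in> B y c \<longleftrightarrow> \<omega> \<in> space M \<and> (\<Sum>j=1..n. X j \<omega>) = real (x - y) \<and>
      X ?k \<omega> \<le> c \<and> (\<forall>i\<in>J. X i \<omega> \<le> z i)" for \<omega> y c
    using k(1) by (auto simp: B_def)
  \<comment> \<open>The bound \<open>c\<close> depends on \<open>y\<close> because both
    \<open>real y\<close> and \<open>real y - 1\<close> are needed; all \<open>y\<close> are handled
    outside one null set.\<close>
  have AE_B: "AE \<omega> in M. \<forall>y. cprob M F (B y (c y)) \<omega> = fps_nth (claim_fps (\<Theta> \<omega>) ^ n) (x - y) *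
      (cprob M F {\<omega> \<in> space M. X ?k \<omega> \<le> c y} \<omega> * (\<Prod>i\<in>J. cprob M F {\<omega> \<in> space M. X i \<omega> \<le> z i} \<omega>))"
    for c :: "nat \<Rightarrow> real"
    unfolding AE_all_countable
  proof
    fix y
    have "insert ?k J \<subseteq> {Suc n..}" using k(3) by auto
    from Suc.IH[OF _ this, of "x - y" "z(?k := c y)"] k(2)
    have IH: "AE \<omega> in M. cprob M F (B y (c y)) \<omega> = fps_nth (claim_fps (\<Theta> \<omega>) ^ n) (x - y) *
        (\<Prod>i\<in>insert ?k J. cprob M F {\<omega> \<in> space M. X i \<omega> \<le> (z(?k := c y)) i} \<omega>)"
      by (simp only: B_def finite_insert simp_thms)
    have prod: "(\<Prod>i\<in>insert ?k J. g i ((z(?k := c y)) i)) = g ?k (c y) * (\<Prod>i\<in>J. g i (z i))"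
      for g :: "nat \<Rightarrow> real \<Rightarrow> real"
    proof -
      have "(\<Prod>i\<in>J. g i ((z(?k := c y)) i)) = (\<Prod>i\<in>J. g i (z i))"
        using k(1) by (intro prod.cong) auto
      then show ?thesis using k(1,2) by simp
    qed
    show "AE \<omega> in M. cprob M F (B y (c y)) \<omega> = fps_nth (claim_fps (\<Theta> \<omega>) ^ n) (x - y) *
      (cprob M F {\<omega> \<in> space M. X ?k \<omega> \<le> c y} \<omega> * (\<Prod>i\<in>J. cprob M F {\<omega> \<in> space M. X i \<omega> \<le> z i} \<omega>))"
      using IH
    proof eventually_elim
      case (elim \<omega>)
      then show ?case
        by (simp only: prod[of "\<lambda>i c. cprob M F {\<omega> \<in> space M. X i \<omega> \<le> c} \<omega>"])
    qed
  qed
  have AE_D: "AE \<omega> in M. \<forall>y. cprob M F (B y (real y) - B y (real y - 1)) \<omega> =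
      cprob M F (B y (real y)) \<omega> - cprob M F (B y (real y - 1)) \<omega>"
    unfolding AE_all_countable by (intro allI cprob_Diff Bev) (auto simp: B_iff)
  have AE_I: "AE \<omega> in M. \<forall>y. cprob M F {\<omega> \<in> space M. X ?k \<omega> \<le> real y} \<omega>
      - cprob M F {\<omega> \<in> space M. X ?k \<omega> \<le> real y - 1} \<omega> = claim_pmf K X (\<Theta> \<omega>) y"
    unfolding AE_all_countable by (intro allI cprob_claim_interval) simp
  have AE_S: "AE \<omega> in M. cprob M F (\<Union>y\<in>{0..x}. B y (real y) - B y (real y - 1)) \<omega> =
      (\<Sum>y=0..x. cprob M F (B y (real y) - B y (real y - 1)) \<omega>)"
  proof (rule cprob_UN_disjoint)
    show "disjoint_family_on (\<lambda>y. B y (real y) - B y (real y - 1)) {0..x}"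
      unfolding disjoint_family_on_def by (auto simp: B_iff)
  qed (auto intro: Bev)
  \<comment> \<open>Almost surely the partial sum and the next claim are natural numbers, so
    \<open>A\<close> splits according to the value \<open>y\<close> of the next claim.\<close>
  have "AE \<omega> in M. \<omega> \<in> A \<longleftrightarrow> \<omega> \<in> (\<Union>y\<in>{0..x}. B y (real y) - B y (real y - 1))"
    using AE_claim_Nats AE_space
  proof eventually_elim
    case (elim \<omega>)
    have "X ?k \<omega> \<in> \<nat>" "(\<Sum>j=1..n. X j \<omega>) \<in> \<nat>"
      using elim by (auto intro!: sum_in_Nats)
    then obtain m s where ms: "X ?k \<omega> = real m" "(\<Sum>j=1..n. X j \<omega>) = real s"
      by (auto elim!: Nats_cases)
    have "\<omega> \<in> A \<longleftrightarrow> s + m = x \<and> (\<forall>i\<in>J. X i \<omega> \<le> z i)"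
      using elim(2) by (simp add: A_def ms[unfolded One_nat_def] flip: of_nat_add)
    also have "\<dots> \<longleftrightarrow> (\<exists>y\<in>{0..x}. s = x - y \<and> m = y \<and> (\<forall>i\<in>J. X i \<omega> \<le> z i))"
      by auto
    also have "\<dots> \<longleftrightarrow> \<omega> \<in> (\<Union>y\<in>{0..x}. B y (real y) - B y (real y - 1))"
    proof -
      have "m = y \<longleftrightarrow> real m \<le> real y \<and> \<not> real m \<le> real y - 1" for y by linarith
      moreover have "real s = real (x - y) \<longleftrightarrow> s = x - y" for y by simp
      ultimately show ?thesis
        using elim(2) unfolding UN_iff Diff_iff B_iff ms by blast
    qed
    finally show ?case .
  qed
  then have AE_A: "AE \<omega> in M. cprob M F A \<omega> = cprob M F (\<Union>y\<in>{0..x}. B y (real y) - B y (real y - 1)) \<omega>"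
    by (rule cprob_cong) (auto intro!: Aev Bev)
  show ?case
    unfolding A_def[symmetric]
    using AE_A AE_S AE_D AE_I AE_B[of real] AE_B[of "\<lambda>y. real y - 1"]
  proof eventually_elim
    case (elim \<omega>)
    let ?P = "\<Prod>i\<in>J. cprob M F {\<omega> \<in> space M. X i \<omega> \<le> z i} \<omega>"
    \<comment> \<open>The two half-line products differ only in the factor of the next claim, whose
      difference is \<open>claim_pmf\<close>. Summation over \<open>y\<close> then gives the Cauchy
      product for the power \<open>Suc n\<close>.\<close>
    have "cprob M F (B y (real y) - B y (real y - 1)) \<omega> =
        claim_pmf K X (\<Theta> \<omega>) y * fps_nth (claim_fps (\<Theta> \<omega>) ^ n) (x - y) * ?P" for y
      unfolding elim(4)[rule_format, of y, symmetric]
      by (simp add: elim(3,5,6) algebra_simps)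
    then have "cprob M F A \<omega> =
        (\<Sum>y=0..x. claim_pmf K X (\<Theta> \<omega>) y * fps_nth (claim_fps (\<Theta> \<omega>) ^ n) (x - y)) * ?P"
      by (simp add: elim(1,2) sum_distrib_right)
    then show ?case by (simp add: fps_mult_nth)
  qed
qed

section \<open>The claim number and its conditional independence of the claims\<close>

abbreviation "claim_number n \<equiv> prob {\<omega> \<in> space M. N \<omega> = n}"

abbreviation "aggregate_event x \<equiv> {\<omega> \<in> space M. agg_sum X N \<omega> = real x}"

lemma claim_number_event: "{\<omega> \<in> space M. N \<omega> = n} \<in> sets (gen_alg M (count_space UNIV) N)"
proof -
  have "{\<omega> \<in> space M. N \<omega> = n} = N -` {n} \<inter> space M" by auto
  also have "\<dots> \<in> sets (gen_alg M (count_space UNIV) N)"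
    unfolding gen_alg_def by (rule in_vimage_algebra) simp
  finally show ?thesis .
qed

text \<open>Independence of \<open>N\<close> and \<Theta> makes the constant a version of the
  conditional probability.\<close>

lemma cprob_claim_number: "AE \<omega> in M. cprob M F {\<omega> \<in> space M. N \<omega> = n} \<omega> = claim_number n"
proof (rule cprob_eqI)
  fix E assume E: "E \<in> sets F"
  have "measure M (E \<inter> {\<omega> \<in> space M. N \<omega> = n}) = claim_number n * measure M E"
    using indep_setD[OF indep_N claim_number_event E] by (simp only: Int_commute)
  moreover have "E \<in> events" using E cond.subalg by (auto simp: subalgebra_def)
  ultimately show "(\<integral>\<omega>\<in>E. claim_number n \<partial>M) = measure M (E \<inter> {\<omega> \<in> space M. N \<omega> = n})"
    by (simp add: set_lebesgue_integral_def)
qed auto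

text \<open>Conditional independence of \<open>N\<close> is available only for events generated by
  the claims, so the partial sum has to be measurable for that sigma-algebra and not merely for
  \<open>M\<close>.\<close>

lemma partial_sum_seq_event: "{\<omega> \<in> space M. (\<Sum>j=1..n. X j \<omega>) = c} \<in> seq_events M X"
proof -
  let ?G = "{X n -` B \<inter> space M | n B. n \<ge> 1 \<and> B \<in> sets borel}"
  let ?W = "sigma (space M) ?G"
  have sets_W: "sets ?W = seq_events M X"
    unfolding seq_events_def by (rule sets_measure_of) auto
  have space_W: "space ?W = space M"
    by (rule space_measure_of) auto
  have "X i \<in> borel_measurable ?W" if "i \<ge> 1" for i
  proof (rule measurableI)
    show "X i -` B \<inter> space ?W \<in> sets ?W" if "B \<in> sets borel" for B
      using that \<open>i \<ge> 1\<close> unfolding sets_W seq_events_def space_W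
      by (intro sigma_sets.Basic) blast
  qed simp
  then have "(\<lambda>\<omega>. \<Sum>j=1..n. X j \<omega>) \<in> borel_measurable ?W"
    by (intro borel_measurable_sum) auto
  then have "(\<lambda>\<omega>. \<Sum>j=1..n. X j \<omega>) -` {c} \<inter> space ?W \<in> sets ?W"
    by (rule measurable_sets) simp
  moreover have "(\<lambda>\<omega>. \<Sum>j=1..n. X j \<omega>) -` {c} \<inter> space M = {\<omega> \<in> space M. (\<Sum>j=1..n. X j \<omega>) = c}"
    by auto
  ultimately show ?thesis by (simp only: sets_W space_W)
qed

lemma cprob_partial_sum:
  "AE \<omega> in M. cprob M F {\<omega> \<in> space M. (\<Sum>j=1..n. X j \<omega>) = real x} \<omega> =
     fps_nth (claim_fps (\<Theta> \<omega>) ^ n) x"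
  using cprob_partial_sum_joint[of "{}" n x] by simp

lemma cprob_partial_sum_claim_number:
  "AE \<omega> in M. cprob M F ({\<omega> \<in> space M. (\<Sum>j=1..n. X j \<omega>) = real x} \<inter> {\<omega> \<in> space M. N \<omega> = n}) \<omega> =
     fps_nth (claim_fps (\<Theta> \<omega>) ^ n) x * claim_number n"
proof -
  have "AE \<omega> in M. cprob M F ({\<omega> \<in> space M. (\<Sum>j=1..n. X j \<omega>) = real x} \<inter> {\<omega> \<in> space M. N \<omega> = n}) \<omega> =
      cprob M F {\<omega> \<in> space M. (\<Sum>j=1..n. X j \<omega>) = real x} \<omega> * cprob M F {\<omega> \<in> space M. N \<omega> = n} \<omega>"
    using cond_indep partial_sum_seq_event claim_number_event unfolding cond_indep_sets_def by blast
  then show ?thesis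
    using cprob_partial_sum[of n x] cprob_claim_number[of n] by eventually_elim simp
qed

section \<open>The aggregate sum as a series over the claim number\<close>

lemma measurable_agg_sum [measurable]: "agg_sum X N \<in> borel_measurable M"
  unfolding agg_sum_def[abs_def]
  by (rule measurable_compose_countable[of "\<lambda>n \<omega>. \<Sum>j=1..n. X j \<omega>"]) measurable

lemma aggregate_event: "aggregate_event x \<in> events"
  by measurable

lemma aggregate_event_eq:
  "aggregate_event x = (\<Union>n. {\<omega> \<in> space M. (\<Sum>j=1..n. X j \<omega>) = real x} \<inter> {\<omega> \<in> space M. N \<omega> = n})"
  by (auto simp: agg_sum_def)

text \<open>The coefficient coincides almost surely with a conditional probability, which is
  integrable; the weight is bounded.\<close>

lemma integrable_mult_claim_fps_power:
  assumes h [measurable]: "h \<in> borel_measurable T"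
    and bd: "\<And>\<omega>. \<omega> \<in> space M \<Longrightarrow> \<bar>h (\<Theta> \<omega>)\<bar> \<le> c"
  shows "integrable M (\<lambda>\<omega>. h (\<Theta> \<omega>) * fps_nth (claim_fps (\<Theta> \<omega>) ^ n) x)"
proof (rule Bochner_Integration.integrable_bound)
  have "integrable M (cprob M F {\<omega> \<in> space M. (\<Sum>j=1..n. X j \<omega>) = real x})"
    by (intro integrable_cprob partial_sum_event)
  then have "integrable M (\<lambda>\<omega>. fps_nth (claim_fps (\<Theta> \<omega>) ^ n) x)"
    by (rule integrable_cong_AE_imp) (use cprob_partial_sum[of n x] in measurable)
  then show "integrable M (\<lambda>\<omega>. c * fps_nth (claim_fps (\<Theta> \<omega>) ^ n) x)"
    by simp
  show "AE \<omega> in M. norm (h (\<Theta> \<omega>) * fps_nth (claim_fps (\<Theta> \<omega>) ^ n) x) \<le>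
      norm (c * fps_nth (claim_fps (\<Theta> \<omega>) ^ n) x)"
    by (rule AE_I2) (auto simp: abs_mult intro!: mult_right_mono order_trans[OF bd])
qed measurable

text \<open>The event \<open>S = x\<close> is split by the value of \<open>N\<close>, and each piece
  is conditioned on \<Theta>. The weight \<open>h\<close> stays free because the recursion
  multiplies it by values of \<open>claim_pmf\<close>.\<close>

lemma integral_aggregate_sums:
  assumes h [measurable]: "h \<in> borel_measurable T"
    and bd: "\<And>\<omega>. \<omega> \<in> space M \<Longrightarrow> \<bar>h (\<Theta> \<omega>)\<bar> \<le> c"
  shows "(\<lambda>n. claim_number n * (\<integral>\<omega>. h (\<Theta> \<omega>) * fps_nth (claim_fps (\<Theta> \<omega>) ^ n) x \<partial>M)) sums
    (\<integral>\<omega>. h (\<Theta> \<omega>) * indicator (aggregate_event x) \<omega> \<partial>M)"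
proof -
  define A where "A n = {\<omega> \<in> space M. (\<Sum>j=1..n. X j \<omega>) = real x} \<inter> {\<omega> \<in> space M. N \<omega> = n}" for n
  have A: "A n \<in> events" for n unfolding A_def by measurable
  have dis: "disjoint_family A" by (auto simp: A_def disjoint_family_on_def)
  have "(\<integral>\<omega>. h (\<Theta> \<omega>) * indicator (A n) \<omega> \<partial>M) =
      claim_number n * (\<integral>\<omega>. h (\<Theta> \<omega>) * fps_nth (claim_fps (\<Theta> \<omega>) ^ n) x \<partial>M)" for n
  proof -
    have [measurable]: "cprob M F (A n) \<in> borel_measurable M"
      using integrable_cprob[OF A] by (rule borel_measurable_integrable)
    have "(\<integral>\<omega>. h (\<Theta> \<omega>) * indicator (A n) \<omega> \<partial>M) = (\<integral>\<omega>. h (\<Theta> \<omega>) * cprob M F (A n) \<omega> \<partial>M)"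
      by (rule integral_mult_cprob[OF A h bd, symmetric])
    also have "\<dots> = (\<integral>\<omega>. claim_number n * (h (\<Theta> \<omega>) * fps_nth (claim_fps (\<Theta> \<omega>) ^ n) x) \<partial>M)"
    proof (rule integral_cong_AE)
      show "AE \<omega> in M. h (\<Theta> \<omega>) * cprob M F (A n) \<omega> =
          claim_number n * (h (\<Theta> \<omega>) * fps_nth (claim_fps (\<Theta> \<omega>) ^ n) x)"
        using cprob_partial_sum_claim_number[of n x, folded A_def] by eventually_elim simp
    qed measurable
    finally show ?thesis by simp
  qed
  moreover have "(\<lambda>\<omega>. h (\<Theta> \<omega>)) \<in> borel_measurable M" by measurable
  ultimately show ?thesis
    using sums_integral_disjoint[of A "\<lambda>\<omega>. h (\<Theta> \<omega>)" c, OF A dis _ bd]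
    by (simp add: aggregate_event_eq A_def)
qed

lemma pmass_agg_sum: "pmass M (agg_sum X N) x = measure M (aggregate_event x)"
  by (simp add: pmass_def)

lemma pmass_eq_integral: "pmass M (agg_sum X N) x = (\<integral>\<omega>. 1 * indicator (aggregate_event x) \<omega> \<partial>M)"
  using aggregate_event[of x] by (simp add: pmass_agg_sum)

section \<open>The value at 0\<close>

lemma summable_claim_number: "summable claim_number"
proof -
  have "(\<lambda>n. measure M {\<omega> \<in> space M. N \<omega> = n}) sums measure M (\<Union>n. {\<omega> \<in> space M. N \<omega> = n})"
    by (rule finite_measure_UNION) (auto simp: disjoint_family_on_def)
  then show ?thesis by (simp add: sums_iff)
qed

lemma prob_gen_sums:
  assumes "\<bar>t\<bar> \<le> 1"
  shows "(\<lambda>n. claim_number n * t ^ n) sums prob_gen M N t"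
proof -
  have "(\<lambda>n. \<integral>\<omega>. t ^ N \<omega> * indicator {\<omega> \<in> space M. N \<omega> = n} \<omega> \<partial>M) sums
      (\<integral>\<omega>. t ^ N \<omega> * indicator (\<Union>n. {\<omega> \<in> space M. N \<omega> = n}) \<omega> \<partial>M)"
    by (rule sums_integral_disjoint[where c = 1])
       (use assms in \<open>auto simp: disjoint_family_on_def power_abs power_le_one\<close>)
  moreover have "(\<integral>\<omega>. t ^ N \<omega> * indicator {\<omega> \<in> space M. N \<omega> = n} \<omega> \<partial>M) = claim_number n * t ^ n" for n
  proof -
    have "(\<integral>\<omega>. t ^ N \<omega> * indicator {\<omega> \<in> space M. N \<omega> = n} \<omega> \<partial>M) =
        (\<integral>\<omega>. t ^ n * indicator {\<omega> \<in> space M. N \<omega> = n} \<omega> \<partial>M)"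
      by (intro Bochner_Integration.integral_cong) (auto simp: indicator_def)
    then show ?thesis by simp
  qed
  moreover have "(\<integral>\<omega>. t ^ N \<omega> * indicator (\<Union>n. {\<omega> \<in> space M. N \<omega> = n}) \<omega> \<partial>M) = prob_gen M N t"
    unfolding prob_gen_def by (intro Bochner_Integration.integral_cong) auto
  ultimately show ?thesis by simp
qed

text \<open>The constant coefficient of \<open>claim_fps \<theta> ^ n\<close> is the
  \<open>n\<close>-th power of \<open>claim_pmf K X \<theta> 0\<close>. The series for
  \<open>h = 1\<close> is thus the integrated power series of \<open>prob_gen\<close>, with the
  exchange of sum and integral dominated by \<open>claim_number\<close>.\<close>

lemma pmass_0: "pmass M (agg_sum X N) 0 = (\<integral>\<omega>. prob_gen M N (claim_pmf K X (\<Theta> \<omega>) 0) \<partial>M)"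
proof -
  let ?f = "\<lambda>\<omega>. claim_pmf K X (\<Theta> \<omega>) 0"
  have f: "0 \<le> ?f \<omega>" "?f \<omega> \<le> 1" if "\<omega> \<in> space M" for \<omega>
    using claim_pmf_bounds[OF Theta_space[OF that]] by auto
  have int: "integrable M (\<lambda>\<omega>. claim_number n * ?f \<omega> ^ n)" for n
    by (intro integrable_mult_right integrable_const_bound[where B = 1] AE_I2)
       (auto simp: f power_abs power_le_one)
  have sums: "(\<lambda>n. \<integral>\<omega>. claim_number n * ?f \<omega> ^ n \<partial>M) sums (\<integral>\<omega>. (\<Sum>n. claim_number n * ?f \<omega> ^ n) \<partial>M)"
  proof (rule sums_integral[OF int])
    have le: "norm (claim_number n * ?f \<omega> ^ n) \<le> claim_number n" if "\<omega> \<in> space M" for n \<omega>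
      using f[OF that] by (simp add: abs_mult mult_left_le power_le_one)
    show "AE \<omega> in M. summable (\<lambda>n. norm (claim_number n * ?f \<omega> ^ n))"
      by (rule AE_I2) (rule summable_comparison_test'[OF summable_claim_number], use le in auto)
    have "(\<integral>\<omega>. norm (claim_number n * ?f \<omega> ^ n) \<partial>M) \<le> (\<integral>\<omega>. claim_number n \<partial>M)" for n
      by (intro integral_mono integrable_norm int le) auto
    then show "summable (\<lambda>n. \<integral>\<omega>. norm (claim_number n * ?f \<omega> ^ n) \<partial>M)"
      by (intro summable_comparison_test'[OF summable_claim_number]) (auto simp: prob_space)
  qed
  have gen: "(\<integral>\<omega>. (\<Sum>n. claim_number n * ?f \<omega> ^ n) \<partial>M) = (\<integral>\<omega>. prob_gen M N (?f \<omega>) \<partial>M)"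
    by (intro Bochner_Integration.integral_cong) (auto intro!: sums_unique[symmetric] prob_gen_sums simp: f)
  have "(\<lambda>n. \<integral>\<omega>. claim_number n * ?f \<omega> ^ n \<partial>M) sums pmass M (agg_sum X N) 0"
    using integral_aggregate_sums[of "\<lambda>_. 1" 1 0]
    by (simp add: fps_nth_power_0 pmass_eq_integral)
  from sums_unique2[OF this sums] gen show ?thesis by simp
qed

section \<open>The recursion\<close>

text \<open>Panjer's factor \<open>a + b / real (Suc n)\<close> is moved onto the coefficient of the
  power \<open>Suc n\<close>, where \<open>fps_nth_power_Suc_weighted\<close> trades it for factors
  free of \<open>n\<close>. The remaining \<open>claim_pmf\<close> joins the weight as
  \<open>hf y\<close>, so each inner series is again of the kind summed by
  \<open>integral_aggregate_sums\<close>.\<close>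

lemma integral_aggregate_recursion:
  assumes panjer: "\<And>n. claim_number (Suc n) = (a + b / real (Suc n)) * claim_number n"
    and h [measurable]: "h \<in> borel_measurable T"
    and bd: "\<And>\<omega>. \<omega> \<in> space M \<Longrightarrow> \<bar>h (\<Theta> \<omega>)\<bar> \<le> c"
    and "x > 0"
  shows "(\<integral>\<omega>. h (\<Theta> \<omega>) * indicator (aggregate_event x) \<omega> \<partial>M) =
    (\<Sum>y=0..x. (a + b * (real y / real x)) *
      (\<integral>\<omega>. h (\<Theta> \<omega>) * claim_pmf K X (\<Theta> \<omega>) y * indicator (aggregate_event (x - y)) \<omega> \<partial>M))"
proof -
  define I where "I h n x = (\<integral>\<omega>. h (\<Theta> \<omega>) * fps_nth (claim_fps (\<Theta> \<omega>) ^ n) x \<partial>M)" for h n x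
  define hf where "hf y \<theta> = h \<theta> * claim_pmf K X \<theta> y" for y \<theta>
  have hf [measurable]: "hf y \<in> borel_measurable T" for y
    unfolding hf_def[abs_def] by measurable
  have hf_bd: "\<bar>hf y (\<Theta> \<omega>)\<bar> \<le> c" if "\<omega> \<in> space M" for y \<omega>
    using bd[OF that] claim_pmf_bounds[OF Theta_space[OF that], of y]
    by (auto simp: hf_def abs_mult intro: order_trans[OF mult_left_le])
  note sums = integral_aggregate_sums[OF h bd, of x, folded I_def]
  \<comment> \<open>The term \<open>n = 0\<close> drops out since \<open>x > 0\<close>, which
    permits the index shift that Panjer's relation requires.\<close>
  have "I h 0 x = 0" using \<open>x > 0\<close> by (simp add: I_def fps_one_nth)
  with sums have "(\<lambda>n. claim_number (Suc n) * I h (Suc n) x) sums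
      (\<integral>\<omega>. h (\<Theta> \<omega>) * indicator (aggregate_event x) \<omega> \<partial>M)"
    by (subst sums_Suc_iff) simp
  moreover have "claim_number (Suc n) * I h (Suc n) x =
      (\<Sum>y=0..x. (a + b * (real y / real x)) * (claim_number n * I (hf y) n (x - y)))" for n
  proof -
    let ?k = "a + b / real (Suc n)"
    have "?k * I h (Suc n) x = (\<integral>\<omega>. ?k * (h (\<Theta> \<omega>) * fps_nth (claim_fps (\<Theta> \<omega>) ^ Suc n) x) \<partial>M)"
      unfolding I_def by (rule integral_mult_right_zero[symmetric])
    also have "\<dots> = (\<integral>\<omega>. (\<Sum>y=0..x. (a + b * (real y / real x)) *
        (hf y (\<Theta> \<omega>) * fps_nth (claim_fps (\<Theta> \<omega>) ^ n) (x - y))) \<partial>M)"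
      unfolding mult.left_commute[of ?k] fps_nth_power_Suc_weighted[OF \<open>x > 0\<close>]
      by (simp add: sum_distrib_left hf_def mult_ac)
    also have "\<dots> = (\<Sum>y=0..x. (a + b * (real y / real x)) * I (hf y) n (x - y))"
      unfolding I_def
      by (subst Bochner_Integration.integral_sum)
         (auto intro!: integrable_mult_claim_fps_power[OF hf hf_bd])
    finally have "claim_number n * (?k * I h (Suc n) x) =
        claim_number n * (\<Sum>y=0..x. (a + b * (real y / real x)) * I (hf y) n (x - y))"
      by (simp only:)
    then show ?thesis
      by (simp only: panjer sum_distrib_left mult_ac)
  qed
  moreover have "(\<lambda>n. \<Sum>y=0..x. (a + b * (real y / real x)) * (claim_number n * I (hf y) n (x - y))) sums
      (\<Sum>y=0..x. (a + b * (real y / real x)) *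
        (\<integral>\<omega>. hf y (\<Theta> \<omega>) * indicator (aggregate_event (x - y)) \<omega> \<partial>M))"
    using integral_aggregate_sums[OF hf hf_bd, folded I_def] by (intro sums_sum sums_mult)
  ultimately show ?thesis
    unfolding hf_def by (simp add: sums_unique2)
qed

text \<open>If \<open>N\<close> had no mass on positive values, every term of the series for the
  mass of \<open>S\<close> at \<open>x > 0\<close> would vanish, contradicting that \<open>x\<close>
  lies in \<open>val_set\<close>. So \<open>Panjer_coefficient_less_1\<close> applies.\<close>

lemma claim_number_panjer_less_1:
  assumes panjer: "\<And>n. claim_number (Suc n) = (a + b / real (Suc n)) * claim_number n"
    and x: "x \<in> val_set M (agg_sum X N)" "x > 0"
  shows "a < 1"
proof -
  have "\<exists>k\<ge>1. claim_number k \<noteq> 0"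
  proof (rule ccontr)
    assume "\<not> ?thesis"
    then have "claim_number n * (\<integral>\<omega>. 1 * fps_nth (claim_fps (\<Theta> \<omega>) ^ n) x \<partial>M) = 0" for n
      using x(2) by (cases n) (auto simp: fps_one_nth)
    then have "(\<lambda>n. claim_number n * (\<integral>\<omega>. 1 * fps_nth (claim_fps (\<Theta> \<omega>) ^ n) x \<partial>M)) = (\<lambda>n. 0)"
      by (rule ext)
    with integral_aggregate_sums[of "\<lambda>_. 1" 1 x] have "(\<lambda>n. 0) sums pmass M (agg_sum X N) x"
      unfolding pmass_eq_integral by (simp only: abs_one order_refl borel_measurable_const simp_thms)
    then show False using x(1) by (simp add: val_set_def sums_iff)
  qed
  then obtain k where k: "k \<ge> 1" "claim_number k \<noteq> 0" by blast
  show ?thesis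
  proof (rule Panjer_coefficient_less_1[OF _ _ summable_claim_number k])
    show "claim_number n = (a + b / real n) * claim_number (n - 1)" if "n \<ge> 1" for n
      using panjer[of "n - 1"] that by simp
  qed simp
qed

text \<open>The mass at \<open>x - y\<close> cancels the normalization in \<open>rho\<close>.
  Outside \<open>val_set\<close> the right-hand integral runs over a null event, so the convention
  that such terms are 0 agrees with it.\<close>

lemma rec_coeff_mult_pmass:
  "(if x - y \<in> val_set M (agg_sum X N)
      then rec_coeff M \<Theta> K X N a b x y * pmass M (agg_sum X N) (x - y) else 0) =
    (a + b * (real y / real x)) *
      (\<integral>\<omega>. claim_pmf K X (\<Theta> \<omega>) y / (1 - a * claim_pmf K X (\<Theta> \<omega>) 0) *
        indicator (aggregate_event (x - y)) \<omega> \<partial>M)"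
proof (cases "x - y \<in> val_set M (agg_sum X N)")
  case True
  then have pos: "measure M (aggregate_event (x - y)) > 0"
    by (simp add: val_set_def pmass_agg_sum)
  have "rho M (agg_sum X N) (x - y) = uniform_measure M (aggregate_event (x - y))"
    using True prob_space_axioms measurable_agg_sum by (intro rho_eq_uniform_measure) auto
  then show ?thesis
    using True pos aggregate_event[of "x - y"]
    by (simp add: rec_coeff_def pmass_agg_sum integral_uniform_measure emeasure_eq_measure)
next
  case False
  then have "measure M (aggregate_event (x - y)) = 0"
    using measure_nonneg[of M "aggregate_event (x - y)"] by (auto simp: val_set_def pmass_agg_sum not_less)
  then show ?thesis
    using False by (simp only: if_False integral_mult_indicator_null[OF aggregate_event] mult_zero_right)
qed

lemma panjer_recursion:
  assumes panjer: "\<And>n. claim_number (Suc n) = (a + b / real (Suc n)) * claim_number n"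
    and x: "x \<in> val_set M (agg_sum X N)" "x > 0"
  shows "pmass M (agg_sum X N) x =
    (\<Sum>y=1..x. if x - y \<in> val_set M (agg_sum X N)
       then rec_coeff M \<Theta> K X N a b x y * pmass M (agg_sum X N) (x - y) else 0)"
proof -
  have "a < 1" by (rule claim_number_panjer_less_1[OF panjer x])
  define h where "h \<theta> = 1 / (1 - a * claim_pmf K X \<theta> 0)" for \<theta>
  let ?f = "\<lambda>\<omega>. claim_pmf K X (\<Theta> \<omega>)"
  let ?S = "\<lambda>x. indicator (aggregate_event x) :: _ \<Rightarrow> real"
  have h [measurable]: "h \<in> borel_measurable T"
    unfolding h_def[abs_def] by measurable
  \<comment> \<open>As \<open>?f \<omega> 0\<close> lies between 0 and 1, the denominator is at
    least \<open>1 - a\<close> for \<open>a \<ge> 0\<close> and at least 1 for \<open>a < 0\<close>;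
    \<open>a < 1\<close> makes this bound positive.\<close>
  have denom: "1 - a * ?f \<omega> 0 \<ge> min 1 (1 - a)" if "\<omega> \<in> space M" for \<omega>
  proof (cases "a \<ge> 0")
    case True
    then show ?thesis
      using mult_left_le[of "?f \<omega> 0" a] claim_pmf_bounds[OF Theta_space[OF that], of 0] by auto
  next
    case False
    then show ?thesis
      using claim_pmf_bounds[OF Theta_space[OF that], of 0] by (simp add: mult_nonpos_nonneg)
  qed
  have bd: "\<bar>h (\<Theta> \<omega>)\<bar> \<le> 1 / min 1 (1 - a)" if "\<omega> \<in> space M" for \<omega>
    using denom[OF that] \<open>a < 1\<close> unfolding h_def abs_divide
    by (intro frac_le) auto
  have int: "integrable M (\<lambda>\<omega>. g (\<Theta> \<omega>) * ?S x \<omega>)"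
    if [measurable]: "g \<in> borel_measurable T" and "\<And>\<omega>. \<omega> \<in> space M \<Longrightarrow> \<bar>g (\<Theta> \<omega>)\<bar> \<le> c" for g c
    by (rule integrable_const_bound[where B = "\<bar>c\<bar>"])
       (use that aggregate_event[of x] in \<open>auto simp: indicator_def intro!: order_trans[OF that(2)]\<close>)
  have bd0: "\<bar>h (\<Theta> \<omega>) * ?f \<omega> 0\<bar> \<le> 1 / min 1 (1 - a)" if "\<omega> \<in> space M" for \<omega>
    using bd[OF that] claim_pmf_bounds[OF Theta_space[OF that], of 0]
    by (auto simp: abs_mult intro: order_trans[OF mult_left_le])
  \<comment> \<open>The choice of \<open>h\<close> means \<open>h - a * h * f 0 = 1\<close>, with
    \<open>f 0\<close> the conditional mass at 0.\<close>
  have "pmass M (agg_sum X N) x = (\<integral>\<omega>. h (\<Theta> \<omega>) * ?S x \<omega> - a * (h (\<Theta> \<omega>) * ?f \<omega> 0 * ?S x \<omega>) \<partial>M)"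
    unfolding pmass_eq_integral
  proof (rule Bochner_Integration.integral_cong)
    fix \<omega> assume "\<omega> \<in> space M"
    then have "1 - a * ?f \<omega> 0 \<noteq> 0" using denom[of \<omega>] \<open>a < 1\<close> by auto
    then have "h (\<Theta> \<omega>) - a * (h (\<Theta> \<omega>) * ?f \<omega> 0) = 1"
      by (simp add: h_def field_simps)
    then show "1 * ?S x \<omega> = h (\<Theta> \<omega>) * ?S x \<omega> - a * (h (\<Theta> \<omega>) * ?f \<omega> 0 * ?S x \<omega>)"
      by (simp add: indicator_def)
  qed simp
  also have "\<dots> = (\<integral>\<omega>. h (\<Theta> \<omega>) * ?S x \<omega> \<partial>M) - a * (\<integral>\<omega>. h (\<Theta> \<omega>) * ?f \<omega> 0 * ?S x \<omega> \<partial>M)"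
    using int[OF h bd] int[of "\<lambda>\<theta>. h \<theta> * claim_pmf K X \<theta> 0", OF _ bd0] by simp
  \<comment> \<open>At \<open>y = 0\<close> the factor \<open>a + b * (real y / real x)\<close> is
    just \<open>a\<close>, so the subtracted integral is exactly the term \<open>y = 0\<close> of
    the recursion for \<open>h\<close>.\<close>
  also have "\<dots> = (\<Sum>y=1..x. (a + b * (real y / real x)) *
      (\<integral>\<omega>. h (\<Theta> \<omega>) * ?f \<omega> y * ?S (x - y) \<omega> \<partial>M))"
  proof -
    have "(\<Sum>y=0..x. g y) = g 0 + (\<Sum>y=1..x. g y)" for g :: "nat \<Rightarrow> real"
      by (simp add: sum.atLeast_Suc_atMost)
    note integral_aggregate_recursion[OF panjer h bd x(2), unfolded this]
    then show ?thesis by (simp only:) simp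
  qed
  also have "\<dots> = (\<Sum>y=1..x. if x - y \<in> val_set M (agg_sum X N)
       then rec_coeff M \<Theta> K X N a b x y * pmass M (agg_sum X N) (x - y) else 0)"
    unfolding rec_coeff_mult_pmass by (simp add: h_def)
  finally show ?thesis .
qed

end

section \<open>The recursion for a random vector \<Theta> with values in \<open>D\<close>\<close>

theorem corollary4p4:
  fixes M :: "'w measure"
    and D :: "(real ^ 'd) set"
    and \<Theta> :: "'w \<Rightarrow> real ^ 'd"
    and K :: "real ^ 'd \<Rightarrow> 'w measure"
    and N :: "'w \<Rightarrow> nat"
    and X :: "nat \<Rightarrow> 'w \<Rightarrow> real"
    and a b :: real
  assumes "prob_space M"
    and "\<Theta> \<in> measurable M (restrict_space borel D)"
    and "N \<in> measurable M (count_space UNIV)"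
    and "\<And>n. n \<ge> 1 \<Longrightarrow> X n \<in> borel_measurable M"
    and "\<And>n \<omega>. n \<ge> 1 \<Longrightarrow> \<omega> \<in> space M \<Longrightarrow> 0 \<le> X n \<omega>"
    and "consistent_rcp M (restrict_space borel D) \<Theta> K"
    and "cond_iid M (gen_alg M (restrict_space borel D) \<Theta>) X"
    and "cond_indep_sets M (gen_alg M (restrict_space borel D) \<Theta>)
           (seq_events M X) (sets (gen_alg M (count_space UNIV) N))"
    and "measure (distr M borel (X 1)) \<nat> = 1"
    and "panjer0 a b (distr M (count_space UNIV) N)"
    and "prob_space.indep_set M (sets (gen_alg M (count_space UNIV) N))
           (sets (gen_alg M (restrict_space borel D) \<Theta>))"
  shows "pmass M (agg_sum X N) 0 = (\<integral>\<omega>. prob_gen M N (claim_pmf K X (\<Theta> \<omega>) 0) \<partial>M) \<and>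
    (\<forall>x \<in> val_set M (agg_sum X N) - {0}.
       pmass M (agg_sum X N) x =
         (\<Sum>y=1..x. if x - y \<in> val_set M (agg_sum X N)
            then rec_coeff M \<Theta> K X N a b x y * pmass M (agg_sum X N) (x - y) else 0))"
proof -
  interpret conditional_iid_claims M "restrict_space borel D" \<Theta> K N X
    using assms(1-4,6-9,11)
    by (simp add: conditional_iid_claims_def conditional_iid_claims_axioms_def)
  have "measure (distr M (count_space UNIV) N) {n} = claim_number n" for n
    by (simp add: measure_distr vimage_def Int_def conj_commute)
  then have "claim_number (Suc n) = (a + b / real (Suc n)) * claim_number n" for n
    using \<open>panjer0 a b (distr M (count_space UNIV) N)\<close>[unfolded panjer0_def, rule_format, of "Suc n"]
    by simp
  then show ?thesis
    using pmass_0 panjer_recursion by blast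
qed

end
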